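(* Let $\Gamma=\{(\cosh t,\ \sinh t): t\in\mathbb R\}\subset\mathbb R^2$ and let $\Lambda=L_1\cup L_2$, where $L_1,L_2\subset\mathbb R^2$ are any two straight lines which intersect at an angle $\alpha\in(0,\tfrac{\pi}{4})$. Then $(\Gamma,\Lambda)$ is a Heisenberg uniqueness pair.
   Context: For a curve $\Gamma\subset\mathbb R^2$ (a finite disjoint union of smooth curves), $X(\Gamma)$ denotes the space of all finite complex-valued Borel measures $\mu$ on $\mathbb R^2$ that are supported on $\Gamma$ and absolutely continuous with respect to the arc length measure on $\Gamma$. The Fourier transform of $\mu$ is $\hat\mu(\xi,\eta)=\int_\Gamma e^{-i\pi(x\xi+y\eta)}\,d\mu(x,y)$ for $(\xi,\eta)\in\mathbb R^2$. For a set $\Lambda\subset\mathbb R^2$, the pair $(\Gamma,\Lambda)$ is a Heisenberg uniqueness pair (HUP) if every $\mu\in X(\Gamma)$ with $\hat\mu(\xi,\eta)=0$ for all $(\xi,\eta)\in\Lambda$ satisfies $\mu=0$. *)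

theory Defs
  imports "HOL-Analysis.Analysis"
begin

subsection \<open>Complex measures and integration against them\<close>

(* Unconditional convergence of the series is automatic, because the condition is
   imposed on every enumeration of the disjoint sets. Values of nu outside the
   sigma-algebra are irrelevant. *)
definition vector_measure :: "'a measure \<Rightarrow> ('a set \<Rightarrow> 'b::real_normed_vector) \<Rightarrow> bool" where
  "vector_measure M \<nu> \<longleftrightarrow>
     \<nu> {} = 0 \<and>
     (\<forall>A::nat \<Rightarrow> 'a set. range A \<subseteq> sets M \<and> disjoint_family A \<longrightarrow>
        (\<lambda>i. \<nu> (A i)) sums \<nu> (\<Union>i. A i))"

(* The positive part of the Jordan decomposition of a real signed measure,
   nu^+(A) = sup {nu(B) : B measurable, B a subset of A}. The function ennreal sends negative
   numbers to 0, which does not change the supremum since B = {} is admissible. *)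
definition upper_variation :: "'a measure \<Rightarrow> ('a set \<Rightarrow> real) \<Rightarrow> 'a measure" where
  "upper_variation M \<nu> =
     measure_of (space M) (sets M) (\<lambda>A. SUP B\<in>{B \<in> sets M. B \<subseteq> A}. ennreal (\<nu> B))"

definition complex_measure_integral ::
    "'a measure \<Rightarrow> ('a set \<Rightarrow> complex) \<Rightarrow> ('a \<Rightarrow> complex) \<Rightarrow> complex" where
  "complex_measure_integral M \<mu> f =
     (integral\<^sup>L (upper_variation M (\<lambda>A. Re (\<mu> A))) f
        - integral\<^sup>L (upper_variation M (\<lambda>A. - Re (\<mu> A))) f)
     + \<i> * (integral\<^sup>L (upper_variation M (\<lambda>A. Im (\<mu> A))) f
        - integral\<^sup>L (upper_variation M (\<lambda>A. - Im (\<mu> A))) f)"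

(* The remaining results of this subsection show that upper_variation really is the
   measure that its definition describes, and that it is finite, so that no default values
   enter complex_measure_integral for bounded measurable integrands. *)

lemma sets_upper_variation [simp, measurable_cong]: "sets (upper_variation M \<nu>) = sets M"
  and space_upper_variation [simp]: "space (upper_variation M \<nu>) = space M"
  by (simp_all add: upper_variation_def sets.space_closed)

lemma vector_measure_Re: "vector_measure M \<mu> \<Longrightarrow> vector_measure M (\<lambda>A. Re (\<mu> A))"
  and vector_measure_Im: "vector_measure M \<mu> \<Longrightarrow> vector_measure M (\<lambda>A. Im (\<mu> A))"
  and vector_measure_uminus: "vector_measure M \<nu> \<Longrightarrow> vector_measure M (\<lambda>A. - \<nu> A)"
  by (auto simp: vector_measure_def intro: sums_Re sums_Im sums_minus)

lemma vector_measure_Un: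
  assumes "vector_measure M \<nu>" "A \<in> sets M" "B \<in> sets M" "A \<inter> B = {}"
  shows "\<nu> (A \<union> B) = \<nu> A + \<nu> B"
proof -
  have "range (binaryset A B) \<subseteq> sets M" "disjoint_family (binaryset A B)"
    using assms by (auto simp: range_binaryset_eq disjoint_family_on_def binaryset_def)
  then have "(\<lambda>i. \<nu> (binaryset A B i)) sums \<nu> (\<Union>i. binaryset A B i)"
    using assms(1) by (auto simp: vector_measure_def)
  moreover have "(\<lambda>i. \<nu> (binaryset A B i)) sums (\<nu> A + \<nu> B)"
    using assms(1) by (intro binaryset_sums) (simp add: vector_measure_def)
  ultimately show ?thesis
    by (simp add: UN_binaryset_eq sums_unique2)
qed

lemma emeasure_upper_variation:
  fixes \<nu> :: "'a set \<Rightarrow> real"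
  assumes \<nu>: "vector_measure M \<nu>" and A: "A \<in> sets M"
  shows "emeasure (upper_variation M \<nu>) A = (SUP B\<in>{B \<in> sets M. B \<subseteq> A}. ennreal (\<nu> B))"
proof (rule emeasure_measure_of[OF upper_variation_def])
  let ?u = "\<lambda>A. SUP B\<in>{B \<in> sets M. B \<subseteq> A}. ennreal (\<nu> B)"
  have empty: "\<nu> {} = 0"
    using \<nu> by (simp add: vector_measure_def)
  have upper: "ennreal (\<nu> B) \<le> ?u A" if "B \<in> sets M" "B \<subseteq> A" for A B
    using that by (intro SUP_upper) auto
  have mono: "?u A \<le> ?u B" if "A \<subseteq> B" for A B
    using that by (intro SUP_subset_mono) auto
  show "sets M \<subseteq> Pow (space M)"
    by (rule sets.space_closed)
  show "A \<in> sets (upper_variation M \<nu>)"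
    using A by simp
  have "?u {} = 0"
  proof -
    have "{B \<in> sets M. B \<subseteq> {}} = {{}}" by auto
    then show ?thesis by (simp add: empty)
  qed
  then show "positive (sets (upper_variation M \<nu>)) ?u"
    by (simp add: positive_def)
  have super: "?u A + ?u B \<le> ?u (A \<union> B)" if disj: "A \<inter> B = {}" for A B
  proof -
    have 1: "ennreal (\<nu> C) + ennreal (\<nu> D) \<le> ?u (A \<union> B)"
      if C: "C \<in> sets M" "C \<subseteq> A" and D: "D \<in> sets M" "D \<subseteq> B" for C D
    proof -
      consider "\<nu> C \<le> 0" | "\<nu> D \<le> 0" | "\<nu> C \<ge> 0" "\<nu> D \<ge> 0" by linarith
      then show ?thesis
      proof cases
        case 1
        have "ennreal (\<nu> D) \<le> ?u (A \<union> B)" using D by (intro upper) auto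
        then show ?thesis using 1 by (simp add: ennreal_neg)
      next
        case 2
        have "ennreal (\<nu> C) \<le> ?u (A \<union> B)" using C by (intro upper) auto
        then show ?thesis using 2 by (simp add: ennreal_neg)
      next
        case 3
        have "C \<inter> D = {}" using C D disj by auto
        then have "ennreal (\<nu> C) + ennreal (\<nu> D) = ennreal (\<nu> (C \<union> D))"
          using 3 C D vector_measure_Un[OF \<nu>, of C D] by simp
        also have "\<dots> \<le> ?u (A \<union> B)" using C D by (intro upper) auto
        finally show ?thesis .
      qed
    qed
    have ne: "{C \<in> sets M. C \<subseteq> A} \<noteq> {}" for A by blast
    have "?u A + ?u B = (SUP C\<in>{C \<in> sets M. C \<subseteq> A}. ennreal (\<nu> C) + ?u B)"
      by (rule ennreal_SUP_add_left[symmetric]) (rule ne)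
    also have "\<dots> \<le> ?u (A \<union> B)"
    proof (rule SUP_least)
      fix C assume C: "C \<in> {C \<in> sets M. C \<subseteq> A}"
      have "ennreal (\<nu> C) + ?u B = (SUP D\<in>{D \<in> sets M. D \<subseteq> B}. ennreal (\<nu> C) + ennreal (\<nu> D))"
        by (rule ennreal_SUP_add_right) (rule ne)
      also have "\<dots> \<le> ?u (A \<union> B)"
        using C by (intro SUP_least 1) auto
      finally show "ennreal (\<nu> C) + ?u B \<le> ?u (A \<union> B)" .
    qed
    finally show ?thesis .
  qed
  show "countably_additive (sets (upper_variation M \<nu>)) ?u"
    unfolding countably_additive_def sets_upper_variation
  proof (intro allI impI antisym)
    fix F :: "nat \<Rightarrow> 'a set"
    assume F: "range F \<subseteq> sets M" and disj: "disjoint_family F" and "\<Union> (range F) \<in> sets M"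
    have fin: "(\<Sum>i<n. ?u (F i)) \<le> ?u (\<Union>i<n. F i)" for n
    proof (induction n)
      case 0
      then show ?case by simp
    next
      case (Suc n)
      have "F i \<inter> F n = {}" if "i < n" for i
        using disj that by (simp add: disjoint_family_on_def)
      then have "(\<Union>i<n. F i) \<inter> F n = {}"
        by blast
      have "(\<Sum>i<Suc n. ?u (F i)) \<le> ?u (\<Union>i<n. F i) + ?u (F n)"
        using Suc by (simp add: add_right_mono)
      also have "\<dots> \<le> ?u ((\<Union>i<n. F i) \<union> F n)"
        by (rule super) fact
      also have "(\<Union>i<n. F i) \<union> F n = (\<Union>i<Suc n. F i)"
        by (auto simp: less_Suc_eq)
      finally show ?case .
    qed
    have "(\<Sum>i<n. ?u (F i)) \<le> ?u (\<Union>i. F i)" for n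
      by (rule order_trans[OF fin]) (rule mono, auto)
    then show "(\<Sum>i. ?u (F i)) \<le> ?u (\<Union>i. F i)"
      by (intro suminf_le_const) auto
    show "?u (\<Union>i. F i) \<le> (\<Sum>i. ?u (F i))"
    proof (rule SUP_least)
      fix B assume B: "B \<in> {B \<in> sets M. B \<subseteq> (\<Union>i. F i)}"
      have "range (\<lambda>i. B \<inter> F i) \<subseteq> sets M" "disjoint_family (\<lambda>i. B \<inter> F i)"
        using B F disj by (auto simp: disjoint_family_on_def)
      then have "(\<lambda>i. \<nu> (B \<inter> F i)) sums \<nu> (\<Union>i. B \<inter> F i)"
        using \<nu> unfolding vector_measure_def by blast
      moreover have "(\<Union>i. B \<inter> F i) = B" using B by auto
      ultimately have "(\<lambda>n. \<Sum>i<n. \<nu> (B \<inter> F i)) \<longlonglongrightarrow> \<nu> B"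
        by (simp add: sums_def)
      then have "(\<lambda>n. ennreal (\<Sum>i<n. \<nu> (B \<inter> F i))) \<longlonglongrightarrow> ennreal (\<nu> B)"
        by (rule tendsto_ennrealI)
      moreover have "ennreal (\<Sum>i<n. \<nu> (B \<inter> F i)) \<le> (\<Sum>i. ?u (F i))" for n
      proof -
        have "ennreal (\<Sum>i<n. \<nu> (B \<inter> F i)) \<le> ennreal (\<Sum>i<n. max 0 (\<nu> (B \<inter> F i)))"
          by (intro ennreal_leI sum_mono) auto
        also have "\<dots> = (\<Sum>i<n. ennreal (max 0 (\<nu> (B \<inter> F i))))"
          by (rule sum_ennreal[symmetric]) simp
        also have "\<dots> \<le> (\<Sum>i<n. ?u (F i))"
        proof (rule sum_mono)
          fix i
          have "ennreal (max 0 (\<nu> (B \<inter> F i))) = ennreal (\<nu> (B \<inter> F i))"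
            by (auto simp: max_def ennreal_neg)
          also have "\<dots> \<le> ?u (F i)" using B F by (intro upper) auto
          finally show "ennreal (max 0 (\<nu> (B \<inter> F i))) \<le> ?u (F i)" .
        qed
        also have "\<dots> \<le> (\<Sum>i. ?u (F i))" by (rule sum_le_suminf) auto
        finally show ?thesis .
      qed
      ultimately show "ennreal (\<nu> B) \<le> (\<Sum>i. ?u (F i))"
        by (intro LIMSEQ_le_const2) auto
    qed
  qed
qed

lemma finite_measure_upper_variation:
  fixes \<nu> :: "'a set \<Rightarrow> real"
  assumes \<nu>: "vector_measure M \<nu>"
  shows "finite_measure (upper_variation M \<nu>)"
proof (rule finite_measureI, rule notI)
  let ?U = "upper_variation M \<nu>"
  assume "emeasure ?U (space ?U) = \<infinity>"
  define P where "P E \<longleftrightarrow> E \<in> sets M \<and> emeasure ?U E = \<infinity>" for E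
  have step: "\<exists>E'. P E' \<and> E' \<subseteq> E \<and> 1 \<le> \<bar>\<nu> (E - E')\<bar>" if E: "P E" for E
  proof -
    have Em: "E \<in> sets M" using E by (simp add: P_def)
    have "(SUP B\<in>{B \<in> sets M. B \<subseteq> E}. ennreal (\<nu> B)) = \<infinity>"
      using E emeasure_upper_variation[OF \<nu> Em] by (simp add: P_def)
    moreover have "ennreal (\<bar>\<nu> E\<bar> + 1) < \<infinity>"
      by (simp only: infinity_ennreal_def ennreal_less_top)
    ultimately have "ennreal (\<bar>\<nu> E\<bar> + 1) < (SUP B\<in>{B \<in> sets M. B \<subseteq> E}. ennreal (\<nu> B))"
      by (simp only:)
    then obtain B where B: "B \<in> sets M" "B \<subseteq> E" "ennreal (\<bar>\<nu> E\<bar> + 1) < ennreal (\<nu> B)"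
      unfolding less_SUP_iff by auto
    then have big: "\<bar>\<nu> E\<bar> + 1 < \<nu> B"
      by (subst (asm) ennreal_less_iff) auto
    have "\<nu> (B \<union> (E - B)) = \<nu> B + \<nu> (E - B)"
      using B Em by (intro vector_measure_Un[OF \<nu>]) auto
    moreover have "B \<union> (E - B) = E" using B by auto
    ultimately have big': "1 \<le> \<bar>\<nu> (E - B)\<bar>" using big by simp
    have "emeasure ?U E = emeasure ?U B + emeasure ?U (E - B)"
      using B Em plus_emeasure[of B ?U "E - B"] \<open>B \<union> (E - B) = E\<close> by simp
    then have "P B \<or> P (E - B)"
      using E B Em by (auto simp: P_def)
    moreover have "E - (E - B) = B" using B by auto
    moreover have "1 \<le> \<bar>\<nu> B\<bar>" using big by linarith
    ultimately show ?thesis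
      using B(2) big' by (elim disjE) (rule exI[of _ B], simp, rule exI[of _ "E - B"], auto)
  qed
  have "P (space M)"
    using \<open>emeasure ?U (space ?U) = \<infinity>\<close> by (simp add: P_def)
  then have "\<exists>E. \<forall>n::nat. P (E n) \<and> (E (Suc n) \<subseteq> E n \<and> 1 \<le> \<bar>\<nu> (E n - E (Suc n))\<bar>)"
    using step by (intro dependent_nat_choice) blast+
  then obtain E :: "nat \<Rightarrow> 'a set"
    where E: "\<And>n. P (E n)" "\<And>n. E (Suc n) \<subseteq> E n \<and> 1 \<le> \<bar>\<nu> (E n - E (Suc n))\<bar>"
    by blast
  have dec: "E n \<subseteq> E m" if "m \<le> n" for m n
    using conjunct1[OF E(2)] that by (rule lift_Suc_antimono_le)
  have "disjoint_family (\<lambda>n. E n - E (Suc n))"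
    unfolding disjoint_family_on_def
  proof (intro ballI impI)
    fix m n :: nat assume "m \<noteq> n"
    then consider "Suc m \<le> n" | "Suc n \<le> m" by linarith
    then show "(E m - E (Suc m)) \<inter> (E n - E (Suc n)) = {}"
      using dec by cases blast+
  qed
  moreover have "range (\<lambda>n. E n - E (Suc n)) \<subseteq> sets M"
    using E(1) by (auto simp: P_def)
  ultimately have "(\<lambda>n. \<nu> (E n - E (Suc n))) sums \<nu> (\<Union>n. E n - E (Suc n))"
    using \<nu> unfolding vector_measure_def by blast
  then have "(\<lambda>n. \<nu> (E n - E (Suc n))) \<longlonglongrightarrow> 0"
    by (intro summable_LIMSEQ_zero) (rule sums_summable)
  then have ev: "eventually (\<lambda>n. dist (\<nu> (E n - E (Suc n))) 0 < 1) sequentially"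
    by (rule tendstoD) simp
  then show False
  proof -
    from ev obtain n where "\<bar>\<nu> (E n - E (Suc n))\<bar> < 1"
      by (auto simp: eventually_sequentially dist_real_def)
    with E(2)[of n] show False by simp
  qed
qed


subsection \<open>Arc length\<close>

(* One-dimensional Hausdorff (outer) measure, normalised so that a segment gets its length. *)
definition hausdorff1 :: "'a::metric_space set \<Rightarrow> ennreal" where
  "hausdorff1 E =
     (SUP \<delta>\<in>{0<..}. INF U\<in>{U::nat \<Rightarrow> 'a set. E \<subseteq> (\<Union>i. U i) \<and>
                                (\<forall>i. bounded (U i) \<and> diameter (U i) \<le> \<delta>)}.
        \<Sum>i. ennreal (diameter (U i)))"

(* On a finite disjoint union of smooth curves, arc length measure is the restriction of
   one-dimensional Hausdorff measure; this form does not depend on a parametrization. *)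
definition arc_length :: "(real \<times> real) set \<Rightarrow> (real \<times> real) set \<Rightarrow> ennreal" where
  "arc_length \<Gamma> E = hausdorff1 (\<Gamma> \<inter> E)"


subsection \<open>Heisenberg uniqueness pairs\<close>

(* X_space Gamma is the space X(Gamma). For a closed curve Gamma (as a subset of the plane), being
   supported on Gamma means that all Borel sets disjoint from Gamma have measure 0. *)
definition X_space :: "(real \<times> real) set \<Rightarrow> ((real \<times> real) set \<Rightarrow> complex) set" where
  "X_space \<Gamma> =
     {\<mu>. vector_measure borel \<mu> \<and>
         (\<forall>E\<in>sets borel. E \<inter> \<Gamma> = {} \<longrightarrow> \<mu> E = 0) \<and>
         (\<forall>E\<in>sets borel. arc_length \<Gamma> E = 0 \<longrightarrow> \<mu> E = 0)}"

(* Integrating over the whole plane agrees with integrating over Gamma for measures supported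
   on Gamma. *)
definition fourier_measure :: "((real \<times> real) set \<Rightarrow> complex) \<Rightarrow> real \<times> real \<Rightarrow> complex" where
  "fourier_measure \<mu> = (\<lambda>(\<xi>, \<eta>).
     complex_measure_integral borel \<mu>
       (\<lambda>(x, y). exp (- \<i> * complex_of_real pi * complex_of_real (x * \<xi> + y * \<eta>))))"

definition heisenberg_uniqueness_pair :: "(real \<times> real) set \<Rightarrow> (real \<times> real) set \<Rightarrow> bool" where
  "heisenberg_uniqueness_pair \<Gamma> \<Lambda> \<longleftrightarrow>
     (\<forall>\<mu>\<in>X_space \<Gamma>. (\<forall>\<zeta>\<in>\<Lambda>. fourier_measure \<mu> \<zeta> = 0) \<longrightarrow> (\<forall>E\<in>sets borel. \<mu> E = 0))"


subsection \<open>Lines\<close>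

definition line :: "real \<times> real \<Rightarrow> real \<times> real \<Rightarrow> (real \<times> real) set" where
  "line p v = {p + t *\<^sub>R v | t. True}"

(* The angle between two lines is the one in [0, pi/2], whence the absolute value. *)
definition lines_intersect_at_angle ::
    "(real \<times> real) set \<Rightarrow> (real \<times> real) set \<Rightarrow> real \<Rightarrow> bool" where
  "lines_intersect_at_angle L\<^sub>1 L\<^sub>2 \<alpha> \<longleftrightarrow>
     (\<exists>p v w. v \<noteq> 0 \<and> w \<noteq> 0 \<and> L\<^sub>1 = line p v \<and> L\<^sub>2 = line p w \<and>
        \<alpha> = arccos (\<bar>v \<bullet> w\<bar> / (norm v * norm w)))"

end

theory Submission
  imports Defs "HOL-Probability.Levy"
begin

text \<open>
  In the parameter \<open>t\<close>, the vanishing of the Fourier transform on a line with direction \<open>v\<close>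
  says that the image of a fixed complex measure on the real line under
  \<open>t \<mapsto> v\<^sub>1 cosh t + v\<^sub>2 sinh t = P e\<^sup>t + Q e\<^sup>-\<^sup>t\<close> is zero; the base point \<open>p\<close> of both lines only
  contributes a unimodular density. If \<open>P Q \<le> 0\<close>, this map is injective and the measure is zero.
  If \<open>P Q > 0\<close>, its fibres are the orbits of the reflection \<open>t \<mapsto> ln (Q / P) - t\<close>, so the measure is
  odd under this reflection. Two non-parallel directions of this kind give two different
  reflections, hence a non-trivial translation that preserves the measure, and a finite
  translation-invariant measure is zero.
\<close>

subsection \<open>Complex measures as densities\<close>

text \<open>Jordan decomposition. For \<open>B \<subseteq> A\<close>, additivity gives
  \<open>- \<nu> B = \<nu> (A - B) - \<nu> A\<close>, which is at most the upper variation of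
  \<open>A\<close> minus \<open>\<nu> A\<close>. The supremum over \<open>B\<close> gives one
  inequality, and the same argument for the negated measure gives the other.\<close>

lemma measure_upper_variation_diff:
  fixes \<nu> :: "'a set \<Rightarrow> real"
  assumes \<nu>: "vector_measure M \<nu>" and A: "A \<in> sets M"
  shows "measure (upper_variation M \<nu>) A - measure (upper_variation M (\<lambda>B. - \<nu> B)) A = \<nu> A"
proof -
  have le: "measure (upper_variation M (\<lambda>B. - \<nu> B)) A \<le> measure (upper_variation M \<nu>) A - \<nu> A"
    if \<nu>: "vector_measure M \<nu>" for \<nu> :: "'a set \<Rightarrow> real"
  proof -
    interpret U: finite_measure "upper_variation M \<nu>"
      by (rule finite_measure_upper_variation[OF \<nu>])
    interpret V: finite_measure "upper_variation M (\<lambda>B. - \<nu> B)"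
      by (rule finite_measure_upper_variation[OF vector_measure_uminus[OF \<nu>]])
    have upper: "\<nu> B \<le> measure (upper_variation M \<nu>) A" if "B \<in> sets M" "B \<subseteq> A" for B
    proof -
      have "ennreal (\<nu> B) \<le> emeasure (upper_variation M \<nu>) A"
        unfolding emeasure_upper_variation[OF \<nu> A] using that by (intro SUP_upper) auto
      then show ?thesis by (simp add: U.emeasure_eq_measure)
    qed
    have "emeasure (upper_variation M (\<lambda>B. - \<nu> B)) A \<le> ennreal (measure (upper_variation M \<nu>) A - \<nu> A)"
      unfolding emeasure_upper_variation[OF vector_measure_uminus[OF \<nu>] A]
    proof (intro SUP_least ennreal_leI)
      fix B assume B: "B \<in> {B \<in> sets M. B \<subseteq> A}"
      then have "\<nu> (B \<union> (A - B)) = \<nu> B + \<nu> (A - B)"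
        using A by (intro vector_measure_Un[OF \<nu>]) auto
      moreover have "B \<union> (A - B) = A" using B by auto
      ultimately show "- \<nu> B \<le> measure (upper_variation M \<nu>) A - \<nu> A"
        using upper[of "A - B"] A B by auto
    qed
    then show ?thesis
      using upper[OF A] by (simp add: V.emeasure_eq_measure)
  qed
  from le[OF \<nu>] le[OF vector_measure_uminus[OF \<nu>]] show ?thesis by simp
qed

text \<open>Serves to build one finite measure that dominates the four variation measures of a
  complex measure.\<close>

lemma finite_measure_add:
  assumes sets: "sets N = sets M" and "finite_measure M" "finite_measure N"
  obtains S where "finite_measure S" "sets S = sets M"
    "\<And>A. A \<in> sets M \<Longrightarrow> emeasure S A = emeasure M A + emeasure N A"
proof
  let ?e = "\<lambda>A. emeasure M A + emeasure N A"
  let ?S = "measure_of (space M) (sets M) ?e"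
  interpret M: finite_measure M by fact
  interpret N: finite_measure N by fact
  have sp: "space N = space M" using sets by (rule sets_eq_imp_space_eq)
  show S: "sets ?S = sets M" by (simp add: sets.space_closed)
  show e: "emeasure ?S A = ?e A" if "A \<in> sets M" for A
  proof (rule emeasure_measure_of[OF refl])
    show "sets M \<subseteq> Pow (space M)" by (rule sets.space_closed)
    show "A \<in> sets ?S" using that S by simp
    show "positive (sets ?S) ?e" by (simp add: positive_def)
    show "countably_additive (sets ?S) ?e"
      unfolding countably_additive_def S
      by (auto simp: suminf_add[symmetric] suminf_emeasure sets)
  qed
  show "finite_measure ?S"
    using sp N.finite_emeasure_space by (intro finite_measureI) (simp add: e sets.space_closed)
qed

text \<open>Radon-Nikodym. Since \<open>V\<close> is finite, its density has a version that is real
  and nonnegative everywhere, and this version is integrable. Hence such densities can be subtracted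
  from each other.\<close>

lemma finite_measure_real_density:
  assumes "finite_measure S" "finite_measure V" and sets: "sets V = sets S"
    and ac: "\<And>A. A \<in> sets S \<Longrightarrow> emeasure S A = 0 \<Longrightarrow> emeasure V A = 0"
  obtains D :: "'a \<Rightarrow> real"
    where "integrable S D" "\<And>x. 0 \<le> D x" "V = density S (\<lambda>x. ennreal (D x))"
proof -
  interpret S: finite_measure S by fact
  interpret V: finite_measure V by fact
  have ac: "absolutely_continuous S V"
    using ac sets by (auto simp: absolutely_continuous_def null_sets_def)
  obtain D where D [measurable]: "D \<in> borel_measurable S"
    and RN: "AE x in S. RN_deriv S V x = ennreal (D x)" and nn: "\<And>x. 0 \<le> D x"
    using S.real_RN_deriv[OF \<open>finite_measure V\<close> ac sets] by metis
  have V: "V = density S (\<lambda>x. ennreal (D x))"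
    using S.density_RN_deriv[OF ac sets] density_cong[OF _ _ RN] by simp
  have "integrable V (\<lambda>x. 1 :: real)" by simp
  then have "integrable S D"
    unfolding V using nn by (subst (asm) integrable_density) auto
  then show ?thesis using nn V by (rule that)
qed

lemma integrable_mult_bounded:
  fixes F G :: "'a \<Rightarrow> complex"
  assumes "integrable M F" "G \<in> borel_measurable M" "\<And>x. norm (G x) \<le> K"
  shows "integrable M (\<lambda>x. F x * G x)"
proof (rule Bochner_Integration.integrable_bound)
  show "integrable M (\<lambda>x. K * norm (F x))" using assms by simp
  show "(\<lambda>x. F x * G x) \<in> borel_measurable M" using assms by measurable
  have "norm (F x) * norm (G x) \<le> \<bar>K\<bar> * norm (F x)" for x
    using assms(3)[of x] by (subst mult.commute, intro mult_right_mono) auto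
  then show "AE x in M. norm (F x * G x) \<le> norm (K * norm (F x))"
    by (auto simp: norm_mult abs_mult)
qed

text \<open>Take for \<open>S\<close> the sum of the four variations of the real and imaginary
  parts, and combine their densities \<open>D1\<close>, ..., \<open>D4\<close> into
  \<open>\<theta>\<close>. Integrals against \<open>\<mu>\<close> then become Bochner integrals
  against one positive measure, to which image measures and dominated convergence apply. The last
  two properties carry null sets from \<open>\<mu>\<close> to \<open>S\<close> and the final
  vanishing from \<open>\<theta>\<close> back to \<open>\<mu>\<close>.\<close>

lemma complex_measure_density:
  fixes \<mu> :: "'a set \<Rightarrow> complex"
  assumes \<mu>: "vector_measure M \<mu>"
  obtains S \<theta> where "finite_measure S" "sets S = sets M" "integrable S \<theta>"
    "\<And>f K. f \<in> borel_measurable M \<Longrightarrow> (\<And>x. norm (f x) \<le> K) \<Longrightarrow>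
      complex_measure_integral M \<mu> f = (CLINT x|S. \<theta> x * f x)"
    "\<And>A. A \<in> sets M \<Longrightarrow> (\<And>B. B \<in> sets M \<Longrightarrow> B \<subseteq> A \<Longrightarrow> \<mu> B = 0) \<Longrightarrow> emeasure S A = 0"
    "\<And>A. (AE x in S. \<theta> x = 0) \<Longrightarrow> A \<in> sets M \<Longrightarrow> \<mu> A = 0"
proof -
  note Re = vector_measure_Re[OF \<mu>] and Im = vector_measure_Im[OF \<mu>]
  note nRe = vector_measure_uminus[OF Re] and nIm = vector_measure_uminus[OF Im]
  define V1 V2 V3 V4 where
    "V1 = upper_variation M (\<lambda>A. Re (\<mu> A))" and "V2 = upper_variation M (\<lambda>A. - Re (\<mu> A))" and
    "V3 = upper_variation M (\<lambda>A. Im (\<mu> A))" and "V4 = upper_variation M (\<lambda>A. - Im (\<mu> A))"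
  note V_defs = V1_def V2_def V3_def V4_def
  have fin: "finite_measure V1" "finite_measure V2" "finite_measure V3" "finite_measure V4"
    using Re nRe Im nIm by (simp_all add: V_defs finite_measure_upper_variation)
  have sets_V [simp]: "sets V1 = sets M" "sets V2 = sets M" "sets V3 = sets M" "sets V4 = sets M"
    by (simp_all add: V_defs)
  obtain S1 where S1: "finite_measure S1" "sets S1 = sets M"
      "\<And>A. A \<in> sets M \<Longrightarrow> emeasure S1 A = emeasure V1 A + emeasure V2 A"
    using finite_measure_add[of V2 V1] fin by auto
  obtain S2 where S2: "finite_measure S2" "sets S2 = sets M"
      "\<And>A. A \<in> sets M \<Longrightarrow> emeasure S2 A = emeasure V3 A + emeasure V4 A"
    using finite_measure_add[of V4 V3] fin by auto
  obtain S where S: "finite_measure S" "sets S = sets M"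
      "\<And>A. A \<in> sets M \<Longrightarrow> emeasure S A = emeasure S1 A + emeasure S2 A"
    using finite_measure_add[of S2 S1] S1 S2 by auto
  note S_eq = S(3) S1(3) S2(3)
  have ac: "emeasure V1 A = 0 \<and> emeasure V2 A = 0 \<and> emeasure V3 A = 0 \<and> emeasure V4 A = 0"
    if "A \<in> sets S" "emeasure S A = 0" for A
    using that S(2) by (simp add: S_eq)
  obtain D1 where D1: "integrable S D1" "\<And>x. 0 \<le> D1 x" "V1 = density S (\<lambda>x. ennreal (D1 x))"
    by (rule finite_measure_real_density[OF S(1) fin(1)]) (use ac S(2) in auto)
  obtain D2 where D2: "integrable S D2" "\<And>x. 0 \<le> D2 x" "V2 = density S (\<lambda>x. ennreal (D2 x))"
    by (rule finite_measure_real_density[OF S(1) fin(2)]) (use ac S(2) in auto)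
  obtain D3 where D3: "integrable S D3" "\<And>x. 0 \<le> D3 x" "V3 = density S (\<lambda>x. ennreal (D3 x))"
    by (rule finite_measure_real_density[OF S(1) fin(3)]) (use ac S(2) in auto)
  obtain D4 where D4: "integrable S D4" "\<And>x. 0 \<le> D4 x" "V4 = density S (\<lambda>x. ennreal (D4 x))"
    by (rule finite_measure_real_density[OF S(1) fin(4)]) (use ac S(2) in auto)
  define \<theta> where "\<theta> x = Complex (D1 x - D2 x) (D3 x - D4 x)" for x
  have \<theta>_eq: "\<theta> = (\<lambda>x. of_real (D1 x) - of_real (D2 x) + \<i> * (of_real (D3 x) - of_real (D4 x)))"
    by (auto simp: \<theta>_def complex_eq_iff)
  show ?thesis
  proof (rule that[of S \<theta>])
    show "finite_measure S" "sets S = sets M" by fact+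
    show "integrable S \<theta>"
      unfolding \<theta>_eq using D1(1) D2(1) D3(1) D4(1) by auto
    show "complex_measure_integral M \<mu> f = (CLINT x|S. \<theta> x * f x)"
      if f: "f \<in> borel_measurable M" "\<And>x. norm (f x) \<le> K" for f K
    proof -
      have fS [measurable]: "f \<in> borel_measurable S"
        using f(1) S(2) by (simp cong: measurable_cong_sets)
      have i: "integrable S (\<lambda>x. of_real (D x) * f x)"
        and e: "integral\<^sup>L (density S (\<lambda>x. ennreal (D x))) f = (CLINT x|S. of_real (D x) * f x)"
        if D: "integrable S D" "\<And>x. 0 \<le> D x" for D
      proof -
        have [measurable]: "D \<in> borel_measurable S" using D by auto
        show "integral\<^sup>L (density S (\<lambda>x. ennreal (D x))) f = (CLINT x|S. of_real (D x) * f x)"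
          using D by (subst integral_density) (auto simp: scaleR_conv_of_real)
        show "integrable S (\<lambda>x. of_real (D x) * f x)"
          using D f(2) by (intro integrable_mult_bounded[where K=K]) auto
      qed
      have "complex_measure_integral M \<mu> f
          = (integral\<^sup>L V1 f - integral\<^sup>L V2 f) + \<i> * (integral\<^sup>L V3 f - integral\<^sup>L V4 f)"
        by (simp add: complex_measure_integral_def V_defs)
      also have "\<dots> = ((CLINT x|S. of_real (D1 x) * f x) - (CLINT x|S. of_real (D2 x) * f x))
          + \<i> * ((CLINT x|S. of_real (D3 x) * f x) - (CLINT x|S. of_real (D4 x) * f x))"
        by (simp only: D1(3) D2(3) D3(3) D4(3) e[OF D1(1,2)] e[OF D2(1,2)] e[OF D3(1,2)] e[OF D4(1,2)])
      also have "\<dots> = (CLINT x|S. of_real (D1 x) * f x - of_real (D2 x) * f x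
          + \<i> * (of_real (D3 x) * f x - of_real (D4 x) * f x))"
        using i[OF D1(1,2)] i[OF D2(1,2)] i[OF D3(1,2)] i[OF D4(1,2)] by simp
      also have "\<dots> = (CLINT x|S. \<theta> x * f x)"
        by (simp add: \<theta>_eq algebra_simps)
      finally show ?thesis .
    qed
    show "emeasure S A = 0" if A: "A \<in> sets M" "\<And>B. B \<in> sets M \<Longrightarrow> B \<subseteq> A \<Longrightarrow> \<mu> B = 0" for A
    proof -
      have "(SUP B\<in>{B \<in> sets M. B \<subseteq> A}. ennreal (h (\<mu> B))) = 0" if "h 0 = 0" for h
        using A(2) that by (auto simp: SUP_eq_iff intro!: antisym SUP_least)
      from this[of Re] this[of Im] this[of "\<lambda>z. - Re z"] this[of "\<lambda>z. - Im z"] show ?thesis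
        using A(1) Re nRe Im nIm by (simp add: S_eq V_defs emeasure_upper_variation)
    qed
    show "\<mu> A = 0" if ae: "AE x in S. \<theta> x = 0" and A: "A \<in> sets M" for A
    proof -
      have D_meas [measurable]: "D1 \<in> borel_measurable S" "D2 \<in> borel_measurable S"
        "D3 \<in> borel_measurable S" "D4 \<in> borel_measurable S"
        using D1(1) D2(1) D3(1) D4(1) by auto
      \<comment> \<open>Where \<open>\<theta>\<close> vanishes, the densities agree in pairs. So the
        positive and negative variations coincide and cancel in the Jordan decomposition.\<close>
      have "AE x in S. ennreal (D1 x) = ennreal (D2 x)"
        using ae by eventually_elim (simp add: \<theta>_def zero_complex.code)
      then have "V1 = V2" unfolding D1(3) D2(3) by (intro density_cong) auto
      have "AE x in S. ennreal (D3 x) = ennreal (D4 x)"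
        using ae by eventually_elim (simp add: \<theta>_def zero_complex.code)
      then have "V3 = V4" unfolding D3(3) D4(3) by (intro density_cong) auto
      show ?thesis
        using measure_upper_variation_diff[OF Re A] measure_upper_variation_diff[OF Im A] \<open>V1 = V2\<close> \<open>V3 = V4\<close>
        by (simp add: V_defs complex_eq_iff)
    qed
  qed
qed

subsection \<open>Uniqueness for one-dimensional Fourier transforms\<close>

text \<open>Levy's uniqueness theorem is about probability distributions, so \<open>u\<close> is
  split into positive and negative parts of common mass \<open>c\<close>. If \<open>c = 0\<close>,
  then \<open>u\<close> vanishes almost everywhere. Otherwise both parts are divided by
  \<open>c\<close>, and their images under \<open>g\<close> have equal characteristic
  functions.\<close>

lemma integral_comp_eq_0_if_char_eq_0_real:
  fixes u :: "'a \<Rightarrow> real" and \<phi> :: "real \<Rightarrow> real"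
  assumes u: "integrable M u" and g [measurable]: "g \<in> borel_measurable M"
    and four: "\<And>s. (CLINT x|M. u x *\<^sub>R iexp (s * g x)) = 0"
    and \<phi> [measurable]: "\<phi> \<in> borel_measurable borel" and bound: "\<And>t. \<bar>\<phi> t\<bar> \<le> K"
  shows "(LINT x|M. u x * \<phi> (g x)) = 0"
proof -
  define p n where "p = (\<lambda>x. max 0 (u x))" and "n = (\<lambda>x. max 0 (- u x))"
  have u_eq: "u x = p x - n x" for x
    by (auto simp: p_def n_def)
  have pn: "integrable M p" "integrable M n"
    using u by (auto simp: p_def n_def)
  have [measurable]: "p \<in> borel_measurable M" "n \<in> borel_measurable M"
    using pn by auto
  have nonneg: "p x \<ge> 0" "n x \<ge> 0" for x
    by (auto simp: p_def n_def)
  have int_bdd: "integrable M (\<lambda>x. h x *\<^sub>R f x)"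
    if h: "integrable M h" and f: "f \<in> borel_measurable M" "\<And>x. norm (f x) \<le> L"
    for h :: "'a \<Rightarrow> real" and f :: "'a \<Rightarrow> 'b::{banach, second_countable_topology}" and L
  proof (rule Bochner_Integration.integrable_bound)
    show "integrable M (\<lambda>x. L * h x)" using h by simp
    show "(\<lambda>x. h x *\<^sub>R f x) \<in> borel_measurable M" using h f(1) by measurable
    have "\<bar>h x\<bar> * norm (f x) \<le> \<bar>L\<bar> * \<bar>h x\<bar>" for x
      using f(2)[of x] by (subst mult.commute, intro mult_right_mono) auto
    then show "AE x in M. norm (h x *\<^sub>R f x) \<le> norm (L * h x)"
      by (auto simp: abs_mult)
  qed
  \<comment> \<open>Frequency 0 shows that the two parts of \<open>u\<close> have the same
    mass.\<close>
  have "(CLINT x|M. u x *\<^sub>R iexp (0 * g x)) = of_real (LINT x|M. u x)"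
    by (simp add: scaleR_conv_of_real)
  then have "(LINT x|M. u x) = 0"
    using four[of 0] by simp
  then have mass: "(LINT x|M. p x) = (LINT x|M. n x)"
    using pn by (simp add: u_eq)
  define c where "c = (LINT x|M. p x)"
  have "c \<ge> 0" using nonneg by (simp add: c_def)
  show ?thesis
  proof (cases "c = 0")
    case True
    then have "AE x in M. p x = 0" "AE x in M. n x = 0"
      using integral_nonneg_eq_0_iff_AE[OF pn(1)] integral_nonneg_eq_0_iff_AE[OF pn(2)] nonneg mass
      by (simp_all add: c_def)
    then have "AE x in M. u x * \<phi> (g x) = 0"
      by eventually_elim (simp add: u_eq)
    then show ?thesis by (rule integral_eq_zero_AE)
  next
    case False
    then have c: "c > 0" using \<open>c \<ge> 0\<close> by simp
    \<comment> \<open>The law of \<open>g\<close> under the probability density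
      \<open>h / c\<close>.\<close>
    define D where "D h = distr (density M (\<lambda>x. ennreal (h x / c))) borel g" for h
    have int_D: "integral\<^sup>L (D h) f = (LINT x|M. (h x / c) *\<^sub>R f (g x))"
      if h [measurable]: "h \<in> borel_measurable M" and "\<And>x. h x \<ge> 0" and f [measurable]: "f \<in> borel_measurable borel"
      for h and f :: "real \<Rightarrow> 'b::{banach, second_countable_topology}"
      unfolding D_def using that c by (subst integral_distr, simp, simp, subst integral_density) auto
    have dist_D: "real_distribution (D h)"
      if h: "integrable M h" and nn: "\<And>x. h x \<ge> 0" and "integral\<^sup>L M h = c" for h
    proof -
      have [measurable]: "h \<in> borel_measurable M" using h by auto
      have "emeasure (density M (\<lambda>x. ennreal (h x / c))) (space M) = (\<integral>\<^sup>+x. ennreal (h x / c) \<partial>M)"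
        by (subst emeasure_density) (auto intro!: nn_integral_cong)
      also have "\<dots> = ennreal (LINT x|M. h x / c)"
        using h nn c by (intro nn_integral_eq_integral) auto
      also have "\<dots> = 1" using that c by simp
      finally have "prob_space (density M (\<lambda>x. ennreal (h x / c)))"
        by (intro prob_spaceI) simp
      then show ?thesis
        unfolding D_def by (intro prob_space.real_distribution_distr) auto
    qed
    have "char (D p) s = char (D n) s" for s
    proof -
      have i: "integrable M (\<lambda>x. h x *\<^sub>R iexp (s * g x))" if "integrable M h" for h
        using int_bdd[OF that, of "\<lambda>x. iexp (s * g x)" 1] by simp
      have "(CLINT x|M. p x *\<^sub>R iexp (s * g x)) - (CLINT x|M. n x *\<^sub>R iexp (s * g x)) = 0"
        using four[of s] i[OF pn(1)] i[OF pn(2)] by (simp add: u_eq scaleR_left_diff_distrib)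
      then have "(CLINT x|M. p x *\<^sub>R iexp (s * g x)) = (CLINT x|M. n x *\<^sub>R iexp (s * g x))"
        by simp
      moreover have "char (D h) s = (1 / c) *\<^sub>R (CLINT x|M. h x *\<^sub>R iexp (s * g x))"
        if "h \<in> borel_measurable M" "\<And>x. h x \<ge> 0" for h
        unfolding char_def using that by (subst int_D) (auto simp flip: integral_scaleR_right)
      ultimately show ?thesis using nonneg by simp
    qed
    then have "D p = D n"
      using dist_D pn nonneg mass by (intro Levy_uniqueness) (auto simp: c_def)
    then have "integral\<^sup>L (D p) \<phi> = integral\<^sup>L (D n) \<phi>" by simp
    then have "(LINT x|M. p x * \<phi> (g x)) = (LINT x|M. n x * \<phi> (g x))"
      using nonneg c by (simp add: int_D)
    moreover have "integrable M (\<lambda>x. h x * \<phi> (g x))" if "integrable M h" for h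
      using int_bdd[OF that, of "\<lambda>x. \<phi> (g x)" K] bound by simp
    ultimately show ?thesis
      using pn by (simp add: u_eq left_diff_distrib)
  qed
qed

text \<open>The transform of the conjugate of \<open>F\<close> at \<open>s\<close> is the conjugate
  of the transform of \<open>F\<close> at \<open>-s\<close>. As the hypothesis covers every
  \<open>s\<close>, it passes to the conjugate and so to the real and imaginary parts, where the
  real version applies.\<close>

lemma integral_comp_eq_0_if_char_eq_0:
  fixes F :: "'a \<Rightarrow> complex" and \<phi> :: "real \<Rightarrow> real"
  assumes F: "integrable M F" and g [measurable]: "g \<in> borel_measurable M"
    and four: "\<And>s. (CLINT x|M. F x * iexp (s * g x)) = 0"
    and \<phi> [measurable]: "\<phi> \<in> borel_measurable borel" and bound: "\<And>t. \<bar>\<phi> t\<bar> \<le> K"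
  shows "(CLINT x|M. F x * of_real (\<phi> (g x))) = 0"
proof -
  have [measurable]: "F \<in> borel_measurable M" using F by auto
  have int: "integrable M (\<lambda>x. G x * iexp (s * g x))" if "integrable M G" for G s
    using that by (intro integrable_mult_bounded[where K=1]) auto
  have cF: "integrable M (\<lambda>x. cnj (F x))" using F by simp
  have "cnj (F x) * iexp (s * g x) = cnj (F x * iexp (- s * g x))" for s x
    by (simp add: exp_cnj)
  then have "(CLINT x|M. cnj (F x) * iexp (s * g x)) = cnj (CLINT x|M. F x * iexp (- s * g x))" for s
    by (simp only: Bochner_Integration.integral_cnj)
  then have four': "(CLINT x|M. cnj (F x) * iexp (s * g x)) = 0" for s
    by (simp only: four complex_cnj_zero)
  have re: "(CLINT x|M. Re (F x) *\<^sub>R iexp (s * g x)) = 0" for s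
  proof -
    have eq: "Re (F x) *\<^sub>R iexp (s * g x) = (F x * iexp (s * g x) + cnj (F x) * iexp (s * g x)) / 2" for x
      using complex_add_cnj[of "F x"] by (simp add: scaleR_conv_of_real flip: distrib_right)
    show ?thesis
      unfolding eq
      using int[OF F, of s] int[OF cF, of s] four[of s] four'[of s] by (simp del: of_real_mult)
  qed
  have im: "(CLINT x|M. Im (F x) *\<^sub>R iexp (s * g x)) = 0" for s
  proof -
    have eq: "Im (F x) *\<^sub>R iexp (s * g x) = (F x * iexp (s * g x) - cnj (F x) * iexp (s * g x)) / (2 * \<i>)" for x
      using complex_diff_cnj[of "F x"] by (simp add: scaleR_conv_of_real flip: left_diff_distrib)
        (simp add: mult_ac)
    show ?thesis
      unfolding eq
      using int[OF F, of s] int[OF cF, of s] four[of s] four'[of s] by (simp del: of_real_mult)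
  qed
  have "integrable M (\<lambda>x. F x * of_real (\<phi> (g x)))"
    using F bound by (intro integrable_mult_bounded[where K=K]) auto
  note ReIm = integral_Re[OF this, symmetric] integral_Im[OF this, symmetric]
  show ?thesis
  proof (rule complex_eqI)
    show "Re (CLINT x|M. F x * of_real (\<phi> (g x))) = Re 0"
      unfolding ReIm
      using integral_comp_eq_0_if_char_eq_0_real[OF integrable_Re[OF F] g re \<phi> bound] by simp
    show "Im (CLINT x|M. F x * of_real (\<phi> (g x))) = Im 0"
      unfolding ReIm
      using integral_comp_eq_0_if_char_eq_0_real[OF integrable_Im[OF F] g im \<phi> bound] by simp
  qed
qed

subsection \<open>Measures on the real line\<close>

text \<open>With \<open>y = P * exp t + Q * exp (- t)\<close>, the quadratic
  \<open>P * X^2 - y * X + Q\<close> has the roots \<open>exp t\<close> and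
  \<open>Q / P * exp (- t)\<close>, and its discriminant is a perfect square. The witness is the
  logarithm of the larger root; for \<open>Q \<le> 0\<close> this root is always
  \<open>exp t\<close>. As \<open>ln\<close> and \<open>sqrt\<close> are total, the witness is Borel
  on the whole line.\<close>

lemma exp_combination_fold:
  fixes P Q :: real
  assumes "P > 0"
  shows "\<exists>k\<in>borel_measurable borel. \<forall>t.
    k (P * exp t + Q * exp (- t)) = (if Q \<le> 0 then t else max t (ln (Q / P) - t))"
proof (intro bexI allI)
  define k where "k y = ln ((y + sqrt (y\<^sup>2 - 4 * P * Q)) / (2 * P))" for y
  show "k \<in> borel_measurable borel"
    unfolding k_def by measurable
  fix t :: real
  have ee: "exp t * exp (- t) = (1::real)"
    by (simp flip: exp_add)
  have "(P * exp t + Q * exp (- t))\<^sup>2 - 4 * P * Q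
      = (P * exp t - Q * exp (- t))\<^sup>2 + 4 * P * Q * (exp t * exp (- t) - 1)"
    by algebra
  then have sq: "sqrt ((P * exp t + Q * exp (- t))\<^sup>2 - 4 * P * Q) = \<bar>P * exp t - Q * exp (- t)\<bar>"
    by (simp add: ee)
  show "k (P * exp t + Q * exp (- t)) = (if Q \<le> 0 then t else max t (ln (Q / P) - t))"
  proof (cases "Q \<le> 0")
    case True
    then have "Q * exp (- t) \<le> 0" "0 \<le> P * exp t"
      using assms by (auto simp: mult_le_0_iff)
    then have "\<bar>P * exp t - Q * exp (- t)\<bar> = P * exp t - Q * exp (- t)"
      by simp
    then show ?thesis
      using True assms by (simp add: k_def sq)
  next
    case False
    have e: "exp (ln (Q / P) - t) = Q / P * exp (- t)"
      using False assms by (simp add: exp_diff exp_minus divide_inverse)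
    have "(P * exp t + Q * exp (- t) + \<bar>P * exp t - Q * exp (- t)\<bar>) / (2 * P)
        = max (exp t) (exp (ln (Q / P) - t))"
      using assms unfolding e by (auto simp: max_def abs_if field_simps)
    also have "\<dots> = exp (max t (ln (Q / P) - t))"
      by (simp add: max_def)
    finally show ?thesis
      using False by (simp add: k_def sq)
  qed
qed

text \<open>A function \<open>\<phi>\<close> that is constant on the fibres of the exponential
  combination factors through it as a Borel function, so the Fourier hypothesis kills its integral.
  Only for \<open>P * Q > 0\<close> are there fibres with two points, and these are swapped by the
  reflection in \<open>sym\<close>.\<close>

lemma exp_combination_even_part:
  fixes P Q :: real and f :: "real \<Rightarrow> complex"
  assumes N: "sets N = sets borel" and f: "integrable N f"
    and PQ: "P \<noteq> 0 \<or> Q \<noteq> 0"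
    and four: "\<And>s. (CLINT t|N. f t * iexp (s * (P * exp t + Q * exp (- t)))) = 0"
    and \<phi> [measurable]: "\<phi> \<in> borel_measurable borel" and bound: "\<And>t. \<bar>\<phi> t\<bar> \<le> K"
    and sym: "P * Q > 0 \<Longrightarrow> \<forall>t. \<phi> (ln (Q / P) - t) = \<phi> t"
  shows "(CLINT t|N. f t * of_real (\<phi> t)) = 0"
proof -
  note [measurable_cong] = N
  have *: "\<exists>k\<in>borel_measurable borel. \<forall>t. \<phi> (k (P * exp t + Q * exp (- t))) = \<phi> t"
  proof -
    consider "P > 0" | "P < 0" | "P = 0" "Q \<noteq> 0" using PQ by linarith
    then show ?thesis
    proof cases
      case 1
      then obtain k where k: "k \<in> borel_measurable borel"
        "\<And>t. k (P * exp t + Q * exp (- t)) = (if Q \<le> 0 then t else max t (ln (Q / P) - t))"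
        using exp_combination_fold[of P Q] by blast
      show ?thesis
        using k sym 1 by (intro bexI[of _ k]) (auto simp: max_def zero_less_mult_iff)
    next
      case 2
      then obtain k where k: "k \<in> borel_measurable borel"
        "\<And>t. k (- P * exp t + - Q * exp (- t)) = (if - Q \<le> 0 then t else max t (ln (- Q / - P) - t))"
        using exp_combination_fold[of "- P" "- Q"] by auto
      have "k (- (P * exp t + Q * exp (- t))) = (if - Q \<le> 0 then t else max t (ln (Q / P) - t))" for t
        using k(2)[of t] by simp
      then show ?thesis
        using k(1) sym 2 by (intro bexI[of _ "\<lambda>y. k (- y)"]) (auto simp: max_def zero_less_mult_iff)
    next
      case 3
      \<comment> \<open>Here the combination is \<open>Q * exp (- t)\<close>, which is inverted
        explicitly.\<close>
      then show ?thesis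
        by (intro bexI[of _ "\<lambda>y. - ln (y / Q)"]) auto
    qed
  qed
  then obtain k where k [measurable]: "k \<in> borel_measurable borel"
    and k_eq: "\<And>t. \<phi> (k (P * exp t + Q * exp (- t))) = \<phi> t" by blast
  have "(CLINT t|N. f t * of_real ((\<phi> \<circ> k) (P * exp t + Q * exp (- t)))) = 0"
    using bound by (intro integral_comp_eq_0_if_char_eq_0[OF f _ four, where K=K]) auto
  then show ?thesis by (simp add: k_eq)
qed

text \<open>The product of \<open>f\<close> and \<open>w\<close> has integral 0 over every
  measurable set, and \<open>w\<close> is positive. The weight permits test functions that decay at
  infinity, as the translation argument requires.\<close>

lemma AE_eq_0_if_weighted_integrals_eq_0:
  fixes f :: "'a \<Rightarrow> complex" and w :: "'a \<Rightarrow> real"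
  assumes "finite_measure N" and f: "integrable N f"
    and w: "w \<in> borel_measurable N" "\<And>x. 0 < w x" "\<And>x. w x \<le> 1"
    and zero: "\<And>A. A \<in> sets N \<Longrightarrow> (CLINT x|N. f x * of_real (indicator A x * w x)) = 0"
  shows "AE x in N. f x = 0"
proof -
  have "integrable N (\<lambda>x. f x * of_real (w x))"
    using f w by (intro integrable_mult_bounded[where K=1]) (auto simp: less_imp_le)
  moreover have "set_lebesgue_integral N A (\<lambda>x. f x * of_real (w x)) = 0" if "A \<in> sets N" for A
    using zero[OF that] by (simp add: set_lebesgue_integral_def scaleR_conv_of_real mult_ac)
  ultimately have "AE x in N. f x * of_real (w x) = 0"
    by (rule sigma_finite_measure.density_zero[OF finite_measure.sigma_finite_measure[OF \<open>finite_measure N\<close>]])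
  then show ?thesis
    by eventually_elim (use w(2) in \<open>auto simp: less_le\<close>)
qed

text \<open>If one of the two products is not positive, that combination alone is injective and
  suffices. Otherwise \<open>f\<close> changes sign under two distinct reflections, so it is
  invariant under their composition, a nonzero translation; iterating it pushes any decaying test
  function off to infinity.\<close>

lemma AE_eq_0_if_two_exp_combinations:
  fixes P Q P' Q' :: real and f :: "real \<Rightarrow> complex"
  assumes N: "finite_measure N" "sets N = sets borel" and f: "integrable N f"
    and det: "P * Q' \<noteq> P' * Q"
    and four: "\<And>s. (CLINT t|N. f t * iexp (s * (P * exp t + Q * exp (- t)))) = 0"
      "\<And>s. (CLINT t|N. f t * iexp (s * (P' * exp t + Q' * exp (- t)))) = 0"
  shows "AE t in N. f t = 0"
proof (rule AE_eq_0_if_weighted_integrals_eq_0[OF N(1) f])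
  note [measurable_cong] = N(2)
  \<comment> \<open>The weight decays in both directions because the sign of the later translation
    is not known.\<close>
  define w :: "real \<Rightarrow> real" where "w t = exp (- t\<^sup>2)" for t
  show w [measurable]: "w \<in> borel_measurable N" unfolding w_def by measurable
  show w_pos: "0 < w t" and w_le: "w t \<le> 1" for t by (auto simp: w_def)
  have nz: "P \<noteq> 0 \<or> Q \<noteq> 0" "P' \<noteq> 0 \<or> Q' \<noteq> 0" using det by auto
  fix A assume A: "A \<in> sets N"
  then have [measurable]: "A \<in> sets borel" using N by simp
  define \<phi> where "\<phi> t = indicator A t * w t" for t
  have \<phi> [measurable]: "\<phi> \<in> borel_measurable borel" unfolding \<phi>_def w_def by measurable
  have bound: "\<bar>\<phi> t\<bar> \<le> 1" for t
    using w_pos[of t] w_le[of t] by (auto simp: \<phi>_def indicator_def abs_if)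
  show "(CLINT t|N. f t * of_real (indicator A t * w t)) = 0"
  proof (cases "P * Q > 0 \<and> P' * Q' > 0")
    case False
    \<comment> \<open>For the combination whose product is not positive, the symmetry condition on
      \<open>\<phi>\<close> is vacuous.\<close>
    then have "(CLINT t|N. f t * of_real (\<phi> t)) = 0"
      using exp_combination_even_part[OF N(2) f nz(1) four(1) \<phi> bound]
        exp_combination_even_part[OF N(2) f nz(2) four(2) \<phi> bound] by blast
    then show ?thesis by (simp add: \<phi>_def)
  next
    case True
    \<comment> \<open>The reflection \<open>t \<mapsto> ln (Q / P) - t\<close> followed by
      \<open>t \<mapsto> ln (Q' / P') - t\<close> is translation by \<open>d\<close>.\<close>
    define d where "d = ln (Q' / P') - ln (Q / P)"
    have pos: "Q / P > 0" "Q' / P' > 0"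
      using True by (auto simp: zero_less_mult_iff zero_less_divide_iff)
    have "P \<noteq> 0" "P' \<noteq> 0" using True by auto
    then have "Q' / P' \<noteq> Q / P"
      using det by (auto simp: frac_eq_eq mult.commute)
    then have "d \<noteq> 0"
      using pos by (simp add: d_def)
    have int: "integrable N (\<lambda>t. f t * of_real (\<psi> t))"
      if "\<psi> \<in> borel_measurable borel" "\<And>t. \<bar>\<psi> t\<bar> \<le> 1" for \<psi> :: "real \<Rightarrow> real"
      using f that by (intro integrable_mult_bounded[where K=1]) auto
    \<comment> \<open>The sum of \<open>\<psi>\<close> and its reflection is invariant under the
      reflection, hence an admissible test function with bound 2.\<close>
    have reflect: "(CLINT t|N. f t * of_real (\<psi> (ln (S / R) - t))) = - (CLINT t|N. f t * of_real (\<psi> t))"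
      if \<psi> [measurable]: "\<psi> \<in> borel_measurable borel" and b: "\<And>t. \<bar>\<psi> t\<bar> \<le> 1"
        and RS: "R * S > 0" and four: "\<And>s. (CLINT t|N. f t * iexp (s * (R * exp t + S * exp (- t)))) = 0"
      for \<psi> :: "real \<Rightarrow> real" and R S
    proof -
      have "(CLINT t|N. f t * of_real (\<psi> t + \<psi> (ln (S / R) - t))) = 0"
      proof (rule exp_combination_even_part[OF N(2) f _ four])
        show "\<bar>\<psi> t + \<psi> (ln (S / R) - t)\<bar> \<le> 2" for t
          using b[of t] b[of "ln (S / R) - t"] by linarith
      qed (use RS in auto)
      then have "(CLINT t|N. f t * of_real (\<psi> t)) + (CLINT t|N. f t * of_real (\<psi> (ln (S / R) - t))) = 0"
        using int[OF \<psi> b] int[of "\<lambda>t. \<psi> (ln (S / R) - t)"] b by (simp add: distrib_left)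
      then show ?thesis by (simp add: add_eq_0_iff)
    qed
    \<comment> \<open>The signs from the two reflections cancel.\<close>
    have shift: "(CLINT t|N. f t * of_real (\<psi> (t + d))) = (CLINT t|N. f t * of_real (\<psi> t))"
      if \<psi> [measurable]: "\<psi> \<in> borel_measurable borel" and b: "\<And>t. \<bar>\<psi> t\<bar> \<le> 1" for \<psi> :: "real \<Rightarrow> real"
    proof -
      have eq: "ln (Q' / P') - (ln (Q / P) - t) = t + d" for t
        by (simp add: d_def)
      have "(CLINT t|N. f t * of_real (\<psi> (ln (Q' / P') - (ln (Q / P) - t))))
          = - (CLINT t|N. f t * of_real (\<psi> (ln (Q' / P') - t)))"
        by (rule reflect[of "\<lambda>t. \<psi> (ln (Q' / P') - t)"]) (use True b four in auto)
      also have "\<dots> = (CLINT t|N. f t * of_real (\<psi> t))"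
        by (subst reflect[of \<psi>]) (use True b four in auto)
      finally show ?thesis unfolding eq .
    qed
    have const: "(CLINT t|N. f t * of_real (\<phi> (t + real n * d))) = (CLINT t|N. f t * of_real (\<phi> t))" for n
    proof (induction n)
      case (Suc n)
      show ?case
        using shift[of "\<lambda>t. \<phi> (t + real n * d)"] bound Suc by (simp add: algebra_simps)
    qed simp
    have lim: "(\<lambda>n. \<phi> (t + real n * d)) \<longlonglongrightarrow> 0" for t
    proof (rule Lim_null_comparison)
      show "eventually (\<lambda>n. norm (\<phi> (t + real n * d)) \<le> w (t + real n * d)) sequentially"
        using w_pos by (auto simp: \<phi>_def indicator_def less_imp_le abs_of_pos)
      \<comment> \<open>Since \<open>d \<noteq> 0\<close>, the points \<open>t + real n * d\<close>
        leave every bounded set, on one side or the other.\<close>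
      have "filterlim (\<lambda>n. \<bar>t + real n * d\<bar>) at_top sequentially"
      proof (rule filterlim_at_top_mono)
        show "filterlim (\<lambda>n. - \<bar>t\<bar> + real n * \<bar>d\<bar>) at_top sequentially"
          using \<open>d \<noteq> 0\<close> by (intro filterlim_tendsto_add_at_top[OF tendsto_const]
              filterlim_at_top_mult_tendsto_pos[OF tendsto_const]) (auto intro: filterlim_real_sequentially)
        show "eventually (\<lambda>n. - \<bar>t\<bar> + real n * \<bar>d\<bar> \<le> \<bar>t + real n * d\<bar>) sequentially"
        proof (intro always_eventually allI)
          fix n
          have "\<bar>real n * d\<bar> = real n * \<bar>d\<bar>" by (simp add: abs_mult)
          then show "- \<bar>t\<bar> + real n * \<bar>d\<bar> \<le> \<bar>t + real n * d\<bar>" by linarith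
        qed
      qed
      then have "filterlim (\<lambda>n. \<bar>t + real n * d\<bar>\<^sup>2) at_top sequentially"
        by (intro filterlim_pow_at_top) auto
      then show "(\<lambda>n. w (t + real n * d)) \<longlonglongrightarrow> 0"
        unfolding w_def by (intro filterlim_compose[OF exp_at_bot]) (simp add: filterlim_uminus_at_top)
    qed
    \<comment> \<open>The norm of \<open>f\<close> dominates, so the integrals tend to 0; by
      \<open>const\<close> they do not depend on \<open>n\<close>, hence they are all 0.\<close>
    have "(\<lambda>n. CLINT t|N. f t * of_real (\<phi> (t + real n * d))) \<longlonglongrightarrow> (CLINT t|N. 0)"
    proof (rule integral_dominated_convergence)
      show "integrable N (\<lambda>t. norm (f t))" using f by simp
      show "AE t in N. (\<lambda>n. f t * of_real (\<phi> (t + real n * d))) \<longlonglongrightarrow> 0"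
      proof (rule AE_I2)
        fix t show "(\<lambda>n. f t * of_real (\<phi> (t + real n * d))) \<longlonglongrightarrow> 0"
          using tendsto_mult_right_zero[OF tendsto_of_real[OF lim[of t], where 'a=complex, simplified], of "f t"]
          by simp
      qed
      show "AE t in N. norm (f t * of_real (\<phi> (t + real n * d))) \<le> norm (f t)" for n
        using bound by (auto simp: norm_mult intro!: mult_left_le)
      show "(\<lambda>t. f t * of_real (\<phi> (t + real n * d))) \<in> borel_measurable N" for n
        using f by measurable
    qed auto
    then have "(\<lambda>n::nat. CLINT t|N. f t * of_real (\<phi> t)) \<longlonglongrightarrow> 0"
      by (simp only: const integral_zero)
    then show ?thesis
      by (simp add: \<phi>_def LIMSEQ_const_iff)
  qed
qed

subsection \<open>Measures on a branch of the hyperbola\<close>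

text \<open>By Lagrange's identity the squares of inner product and determinant add up to the
  squared product of the norms. A zero determinant would make the argument of \<open>arccos\<close>
  equal to 1 and the angle 0.\<close>

lemma det_nonzero_if_angle_nonzero:
  fixes v w :: "real \<times> real"
  assumes "v \<noteq> 0" "w \<noteq> 0" and \<alpha>: "arccos (\<bar>v \<bullet> w\<bar> / (norm v * norm w)) \<noteq> 0"
  shows "fst v * snd w \<noteq> snd v * fst w"
proof
  assume det: "fst v * snd w = snd v * fst w"
  have "(v \<bullet> w)\<^sup>2 + (fst v * snd w - snd v * fst w)\<^sup>2 = (v \<bullet> v) * (w \<bullet> w)"
    by (simp add: inner_prod_def power2_eq_square algebra_simps)
  then have "(v \<bullet> w)\<^sup>2 = (norm v * norm w)\<^sup>2"
    using det by (simp add: power_mult_distrib power2_norm_eq_inner)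
  then have "sqrt ((v \<bullet> w)\<^sup>2) = sqrt ((norm v * norm w)\<^sup>2)"
    by (simp only:)
  then have "\<bar>v \<bullet> w\<bar> = norm v * norm w"
    by (simp add: abs_mult)
  then show False
    using assms by simp
qed

text \<open>Exhibits the branch as the solution set of a continuous equation, from which closedness
  follows.\<close>

lemma hyperbola_branch_eq:
  "{(cosh t, sinh t) | t::real. t \<in> UNIV} = {z. fst z = sqrt ((snd z)\<^sup>2 + 1)}"
proof (intro set_eqI iffI)
  fix z :: "real \<times> real"
  assume "z \<in> {(cosh t, sinh t) | t::real. t \<in> UNIV}"
  then obtain t where "z = (cosh t, sinh t)" by blast
  then show "z \<in> {z. fst z = sqrt ((snd z)\<^sup>2 + 1)}"
    by (simp flip: cosh_square_eq)
next
  fix z :: "real \<times> real"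
  assume "z \<in> {z. fst z = sqrt ((snd z)\<^sup>2 + 1)}"
  then have "z = (cosh (arsinh (snd z)), sinh (arsinh (snd z)))"
    by (simp add: prod_eq_iff cosh_arsinh_real)
  then show "z \<in> {(cosh t, sinh t) | t::real. t \<in> UNIV}" by blast
qed

text \<open>Transports \<open>S\<close> to the real line by the parameter of the curve. Each line
  then yields the vanishing of a transform along one exponential combination, and independence of
  the directions becomes independence of the coefficient pairs.\<close>

lemma AE_eq_0_if_Fourier_eq_0_on_two_lines:
  fixes S :: "(real \<times> real) measure" and \<theta> :: "real \<times> real \<Rightarrow> complex" and p v w :: "real \<times> real"
  assumes S: "finite_measure S" "sets S = sets borel" and \<theta>: "integrable S \<theta>"
    and supp: "AE z in S. \<exists>t. z = (cosh t, sinh t)"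
    and det: "fst v * snd w \<noteq> snd v * fst w"
    and zero: "\<And>\<zeta>. \<zeta> \<in> line p v \<union> line p w \<Longrightarrow> (CLINT z|S. \<theta> z * iexp (- pi * (z \<bullet> \<zeta>))) = 0"
  shows "AE z in S. \<theta> z = 0"
proof -
  note [measurable_cong] = S(2)
  have [measurable]: "\<theta> \<in> borel_measurable S" using \<theta> by auto
  then have [measurable]: "\<theta> \<in> borel_measurable borel"
    using S(2) by (simp cong: measurable_cong_sets)
  \<comment> \<open>A left inverse of the parametrization \<open>\<gamma>\<close> that is continuous
    on the whole plane.\<close>
  define \<tau> where "\<tau> z = arsinh (snd z)" for z :: "real \<times> real"
  define \<gamma> where "\<gamma> t = (cosh t, sinh t)" for t :: real
  have "arsinh \<in> borel_measurable (borel :: real measure)"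
    by (intro borel_measurable_continuous_onI continuous_intros)
  then have \<tau>_meas [measurable]: "\<tau> \<in> borel_measurable borel"
    unfolding \<tau>_def by (rule measurable_compose[rotated])
      (intro borel_measurable_continuous_onI continuous_intros)
  have "(cosh :: real \<Rightarrow> real) \<in> borel_measurable borel" "(sinh :: real \<Rightarrow> real) \<in> borel_measurable borel"
    by (intro borel_measurable_continuous_onI continuous_intros)+
  then have \<gamma>_meas [measurable]: "\<gamma> \<in> borel_measurable borel"
    unfolding \<gamma>_def by (intro borel_measurable_Pair)
  have AE_\<Gamma>: "AE z in S. \<gamma> (\<tau> z) = z"
    using supp by eventually_elim (auto simp: \<gamma>_def \<tau>_def arsinh_sinh_real)
  \<comment> \<open>The phase of the common base point \<open>p\<close> goes into the density, so
    that both lines may be treated as passing through the origin.\<close>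
  define F where "F z = \<theta> z * iexp (- pi * (z \<bullet> p))" for z
  define f where "f t = F (\<gamma> t)" for t
  define N where "N = distr S borel \<tau>"
  have F: "integrable S F"
    unfolding F_def using \<theta> by (intro integrable_mult_bounded[where K=1]) auto
  have F_meas [measurable]: "F \<in> borel_measurable borel"
    unfolding F_def by measurable
  have f_meas [measurable]: "f \<in> borel_measurable borel"
    unfolding f_def by measurable
  have f_\<tau>: "AE z in S. f (\<tau> z) = F z"
    using AE_\<Gamma> by eventually_elim (simp add: f_def)
  have "integrable N f"
  proof -
    have "integrable S (\<lambda>z. f (\<tau> z))"
      using F by (subst integrable_cong_AE[OF _ _ f_\<tau>]) auto
    then show ?thesis unfolding N_def by (subst integrable_distr_eq) auto
  qed
  have vanish: "(CLINT t|N. f t * iexp (s * ((fst u + snd u) / 2 * exp t + (fst u - snd u) / 2 * exp (- t)))) = 0"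
    if u: "line p u \<subseteq> line p v \<union> line p w" for u s
  proof -
    \<comment> \<open>The factor \<open>- s / pi\<close> compensates the \<open>- pi\<close> of the
      Fourier kernel, so \<open>s\<close> runs over all frequencies.\<close>
    define \<zeta> where "\<zeta> = p + (- s / pi) *\<^sub>R u"
    have "\<zeta> \<in> line p u"
      unfolding \<zeta>_def line_def by blast
    then have \<zeta>: "\<zeta> \<in> line p v \<union> line p w"
      using u by blast
    have twist: "F z * iexp (s * (z \<bullet> u)) = \<theta> z * iexp (- pi * (z \<bullet> \<zeta>))" for z
    proof -
      have "- pi * (z \<bullet> p) + s * (z \<bullet> u) = - pi * (z \<bullet> \<zeta>)"
        by (simp add: \<zeta>_def inner_add_right inner_diff_right field_simps)
      then have "iexp (- pi * (z \<bullet> p)) * iexp (s * (z \<bullet> u)) = iexp (- pi * (z \<bullet> \<zeta>))"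
        by (simp only: flip: exp_add distrib_left of_real_add)
      then show ?thesis
        by (simp only: F_def mult.assoc)
    qed
    have "(fst u + snd u) / 2 * exp t + (fst u - snd u) / 2 * exp (- t) = \<gamma> t \<bullet> u" for t
      by (simp add: \<gamma>_def inner_prod_def cosh_def sinh_def field_simps)
    then have "(CLINT t|N. f t * iexp (s * ((fst u + snd u) / 2 * exp t + (fst u - snd u) / 2 * exp (- t))))
        = (CLINT t|N. f t * iexp (s * (\<gamma> t \<bullet> u)))"
      by (simp only:)
    also have "\<dots> = (CLINT z|S. f (\<tau> z) * iexp (s * (\<gamma> (\<tau> z) \<bullet> u)))"
      unfolding N_def by (subst integral_distr) auto
    also have "\<dots> = (CLINT z|S. F z * iexp (s * (z \<bullet> u)))"
    proof (rule integral_cong_AE)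
      show "AE z in S. f (\<tau> z) * iexp (s * (\<gamma> (\<tau> z) \<bullet> u)) = F z * iexp (s * (z \<bullet> u))"
        using AE_\<Gamma> f_\<tau> by eventually_elim simp
    qed auto
    also have "\<dots> = (CLINT z|S. \<theta> z * iexp (- pi * (z \<bullet> \<zeta>)))"
      by (simp only: twist)
    also have "\<dots> = 0"
      by (rule zero[OF \<zeta>])
    finally show ?thesis .
  qed
  have "AE t in N. f t = 0"
  proof (rule AE_eq_0_if_two_exp_combinations)
    show "finite_measure N" unfolding N_def using S(1) by (rule finite_measure.finite_measure_distr) auto
    show "sets N = sets borel" by (simp add: N_def)
    \<comment> \<open>Passing to the coefficients of \<open>exp t\<close> and
      \<open>exp (- t)\<close> multiplies the determinant by -1/2.\<close>
    show "(fst v + snd v) / 2 * ((fst w - snd w) / 2) \<noteq> (fst w + snd w) / 2 * ((fst v - snd v) / 2)"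
      using det by (simp add: field_simps)
  qed (use \<open>integrable N f\<close> vanish in auto)
  then have "AE z in S. f (\<tau> z) = 0"
    unfolding N_def by (rule AE_distrD[rotated]) auto
  \<comment> \<open>\<open>F\<close> and \<open>\<theta>\<close> differ by a factor of modulus 1, so
    they have the same zeros.\<close>
  with f_\<tau> show ?thesis
    by eventually_elim (auto simp: F_def)
qed

theorem theorem2p13:
  fixes \<Gamma> \<Lambda> L\<^sub>1 L\<^sub>2 :: "(real \<times> real) set" and \<alpha> :: real
  assumes "\<Gamma> = {(cosh t, sinh t) | t::real. t \<in> UNIV}"
    and "\<alpha> \<in> {0<..<pi / 4}"
    and "lines_intersect_at_angle L\<^sub>1 L\<^sub>2 \<alpha>"
    and "\<Lambda> = L\<^sub>1 \<union> L\<^sub>2"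
  shows "heisenberg_uniqueness_pair \<Gamma> \<Lambda>"
  unfolding heisenberg_uniqueness_pair_def
proof (intro ballI impI)
  fix \<mu> and E :: "(real \<times> real) set"
  assume \<mu>: "\<mu> \<in> X_space \<Gamma>" and zero: "\<forall>\<zeta>\<in>\<Lambda>. fourier_measure \<mu> \<zeta> = 0" and E: "E \<in> sets borel"
  obtain p v w where vw: "v \<noteq> 0" "w \<noteq> 0" and L: "L\<^sub>1 = line p v" "L\<^sub>2 = line p w"
    and \<alpha>: "\<alpha> = arccos (\<bar>v \<bullet> w\<bar> / (norm v * norm w))"
    using assms(3) unfolding lines_intersect_at_angle_def by blast
  have det: "fst v * snd w \<noteq> snd v * fst w"
    using det_nonzero_if_angle_nonzero[OF vw] \<alpha> assms(2) by auto
  have vm: "vector_measure borel \<mu>" and supp: "\<And>B. B \<in> sets borel \<Longrightarrow> B \<inter> \<Gamma> = {} \<Longrightarrow> \<mu> B = 0"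
    using \<mu> by (auto simp: X_space_def)
  obtain S \<theta> where S: "finite_measure S" "sets S = sets borel" and \<theta>: "integrable S \<theta>"
    and int_S: "\<And>f K. f \<in> borel_measurable borel \<Longrightarrow> (\<And>x. norm (f x) \<le> K) \<Longrightarrow>
      complex_measure_integral borel \<mu> f = (CLINT x|S. \<theta> x * f x)"
    and null_S: "\<And>A. A \<in> sets borel \<Longrightarrow> (\<And>B. B \<in> sets borel \<Longrightarrow> B \<subseteq> A \<Longrightarrow> \<mu> B = 0) \<Longrightarrow> emeasure S A = 0"
    and \<mu>_zero: "\<And>A. (AE x in S. \<theta> x = 0) \<Longrightarrow> A \<in> sets borel \<Longrightarrow> \<mu> A = 0"
    using complex_measure_density[OF vm] by blast
  have \<Gamma>_closed: "closed \<Gamma>"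
    unfolding assms(1) hyperbola_branch_eq by (intro closed_Collect_eq continuous_intros)
  \<comment> \<open>The complement is Borel because \<open>\<Gamma>\<close> is closed, and
    \<open>\<mu>\<close> vanishes on each of its Borel subsets.\<close>
  have "emeasure S (- \<Gamma>) = 0"
    using \<Gamma>_closed supp by (intro null_S) auto
  then have "AE z in S. z \<in> \<Gamma>"
    using \<Gamma>_closed S(2) by (intro AE_I[where N="- \<Gamma>"]) (auto simp: sets_eq_imp_space_eq)
  then have AE_\<Gamma>: "AE z in S. \<exists>t. z = (cosh t, sinh t)"
    by eventually_elim (auto simp: assms(1))
  have "AE z in S. \<theta> z = 0"
  proof (rule AE_eq_0_if_Fourier_eq_0_on_two_lines[OF S \<theta> AE_\<Gamma> det])
    fix \<zeta> assume "\<zeta> \<in> line p v \<union> line p w"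
    then have "fourier_measure \<mu> \<zeta> = 0"
      using zero assms(4) L by blast
    moreover have "fourier_measure \<mu> \<zeta> = complex_measure_integral borel \<mu> (\<lambda>z. iexp (- pi * (z \<bullet> \<zeta>)))"
      by (simp add: fourier_measure_def case_prod_beta' inner_prod_def mult.assoc)
    moreover have "\<dots> = (CLINT z|S. \<theta> z * iexp (- pi * (z \<bullet> \<zeta>)))"
      by (rule int_S[where K=1]) auto
    ultimately show "(CLINT z|S. \<theta> z * iexp (- pi * (z \<bullet> \<zeta>))) = 0"
      by simp
  qed
  then show "\<mu> E = 0"
    using \<mu>_zero E by blast
qed

end
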